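(* Let $T$ be a non-deterministic register transducer with $k$ registers. Then for every $X\subseteq\mathcal{D}$ with $|X|\geq 2k+3$ and $d_0\in X$, $T$ is functional if and only if $[\![T]\!]\cap\big((\Sigma\times X)^\omega\times(\Gamma\times X)^\omega\big)$ is functional (i.e. is a partial function).
   Context: Fix finite alphabets $\Sigma,\Gamma$, a countably infinite set $\mathcal{D}$ of data values and a distinguished $d_0\in\mathcal{D}$. A test over a finite register set $R$ is a Boolean combination of $\top,\bot,r^{=},r^{\neq}$ ($r\in R$); for $\tau:R\to\mathcal{D}$ and $d\in\mathcal{D}$, $\tau,d\models r^{=}$ iff $\tau(r)=d$, $\tau,d\models r^{\neq}$ iff $\tau(r)\neq d$. A non-deterministic register transducer (NRT) is $T=(Q,R,i_0,F,\Delta)$ with finite states $Q$, initial $i_0$, accepting $F\subseteq Q$, finite register set $R$ ($k=|R|$), and finite $\Delta\subseteq Q\times\Sigma\times\mathrm{Tests}_R\times2^R\times(\Gamma\times R)^*\times Q$. From configuration $(q,\tau)$, reading $(\sigma,d)$, a transition $(q,\sigma,\phi,\mathrm{asgn},o,q')$ with $\tau,d\models\phi$ leads to $(q',\tau')$ with $\tau'(r)=d$ if $r\in\mathrm{asgn}$ and $\tau'(r)=\tau(r)$ otherwise, outputting $(\gamma_1,\tau'(r_1))\cdots(\gamma_m,\tau'(r_m))$ where $o=(\gamma_1,r_1)\cdots(\gamma_m,r_m)$. An accepting run starts in $i_0$ with all registers equal to $d_0$ and visits $F$ infinitely often; standing assumption: accepting runs produce infinite outputs. $[\![T]\!]\subseteq(\Sigma\times\mathcal{D})^\omega\times(\Gamma\times\mathcal{D})^\omega$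 is the set of pairs (input, output) of accepting runs. $T$ is functional if $[\![T]\!]$ is a partial function. *)

theory Defs
  imports Main "HOL-Library.Stream" "HOL-Library.Countable" "HOL-Library.Infinite_Typeclass"
begin

datatype (test_regs: 'r) test =
    TTrue
  | TFalse
  | REq 'r
  | RNeq 'r
  | TNot "'r test"
  | TAnd "'r test" "'r test"
  | TOr "'r test" "'r test"

primrec test_sat :: "('r \<Rightarrow> 'd) \<Rightarrow> 'd \<Rightarrow> 'r test \<Rightarrow> bool" where
  "test_sat \<tau> d TTrue \<longleftrightarrow> True"
| "test_sat \<tau> d TFalse \<longleftrightarrow> False"
| "test_sat \<tau> d (REq r) \<longleftrightarrow> \<tau> r = d"
| "test_sat \<tau> d (RNeq r) \<longleftrightarrow> \<tau> r \<noteq> d"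
| "test_sat \<tau> d (TNot \<phi>) \<longleftrightarrow> \<not> test_sat \<tau> d \<phi>"
| "test_sat \<tau> d (TAnd \<phi> \<psi>) \<longleftrightarrow> test_sat \<tau> d \<phi> \<and> test_sat \<tau> d \<psi>"
| "test_sat \<tau> d (TOr \<phi> \<psi>) \<longleftrightarrow> test_sat \<tau> d \<phi> \<or> test_sat \<tau> d \<psi>"

type_synonym ('q, 'r, 's, 'g) transition =
  "'q \<times> 's \<times> 'r test \<times> 'r set \<times> ('g \<times> 'r) list \<times> 'q"

record ('q, 'r, 's, 'g) transducer =
  states :: "'q set"
  registers :: "'r set"
  initial :: 'q
  accepting :: "'q set"
  transitions :: "('q, 'r, 's, 'g) transition set"

definition nrt :: "('q, 'r, 's::finite, 'g::finite) transducer \<Rightarrow> bool" where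
  "nrt T \<longleftrightarrow>
     finite (states T) \<and> finite (registers T) \<and>
     initial T \<in> states T \<and> accepting T \<subseteq> states T \<and>
     finite (transitions T) \<and>
     transitions T \<subseteq> states T \<times> UNIV \<times> {\<phi>. test_regs \<phi> \<subseteq> registers T}
       \<times> Pow (registers T) \<times> lists (UNIV \<times> registers T) \<times> states T"

text \<open>Valuations are total functions on the type of registers. Transitions of a transducer
  satisfying \<^const>\<open>nrt\<close> neither read nor change their values outside \<^const>\<open>registers\<close>,
  where they remain equal to the initial value.\<close>

type_synonym ('q, 'r, 'd) config = "'q \<times> ('r \<Rightarrow> 'd)"

definition update :: "('r \<Rightarrow> 'd) \<Rightarrow> 'r set \<Rightarrow> 'd \<Rightarrow> 'r \<Rightarrow> 'd" where
  "update \<tau> A d = (\<lambda>r. if r \<in> A then d else \<tau> r)"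

inductive step ::
  "('q, 'r, 's, 'g) transducer \<Rightarrow> ('q, 'r, 'd) config \<Rightarrow> 's \<times> 'd \<Rightarrow> ('g \<times> 'd) list
     \<Rightarrow> ('q, 'r, 'd) config \<Rightarrow> bool" for T where
  "\<lbrakk>(q, \<sigma>, \<phi>, asgn, out, q') \<in> transitions T; test_sat \<tau> d \<phi>; \<tau>' = update \<tau> asgn d\<rbrakk>
    \<Longrightarrow> step T (q, \<tau>) (\<sigma>, d) (map (\<lambda>(\<gamma>, r). (\<gamma>, \<tau>' r)) out) (q', \<tau>')"

definition accepting_run ::
  "'d \<Rightarrow> ('q, 'r, 's, 'g) transducer \<Rightarrow> ('s \<times> 'd) stream \<Rightarrow> (nat \<Rightarrow> ('q, 'r, 'd) config)
     \<Rightarrow> (nat \<Rightarrow> ('g \<times> 'd) list) \<Rightarrow> bool" where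
  "accepting_run d0 T x c out \<longleftrightarrow>
     c 0 = (initial T, \<lambda>_. d0) \<and>
     (\<forall>n. step T (c n) (x !! n) (out n) (c (Suc n))) \<and>
     (\<exists>\<^sub>\<infinity>n. fst (c n) \<in> accepting T)"

definition infinite_outputs :: "'d \<Rightarrow> ('q, 'r, 's, 'g) transducer \<Rightarrow> bool" where
  "infinite_outputs d0 T \<longleftrightarrow>
     (\<forall>x c out. accepting_run d0 T x c out \<longrightarrow> (\<exists>\<^sub>\<infinity>n. out n \<noteq> []))"

text \<open>\<open>concatenates_to u w\<close>: the infinite concatenation \<open>u 0 @ u 1 @ \<dots>\<close>, in which
  individual factors may be empty, is the infinite word \<open>w\<close>.\<close>

definition concatenates_to :: "(nat \<Rightarrow> 'a list) \<Rightarrow> 'a stream \<Rightarrow> bool" where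
  "concatenates_to u w \<longleftrightarrow>
     (\<exists>\<^sub>\<infinity>n. u n \<noteq> []) \<and>
     (\<forall>n. \<exists>w'. w = concat (map u [0..<n]) @- w')"

definition semantics ::
  "'d \<Rightarrow> ('q, 'r, 's, 'g) transducer \<Rightarrow> (('s \<times> 'd) stream \<times> ('g \<times> 'd) stream) set" where
  "semantics d0 T =
     {(x, y). \<exists>c out. accepting_run d0 T x c out \<and> concatenates_to out y}"

definition functional :: "'d \<Rightarrow> ('q, 'r, 's, 'g) transducer \<Rightarrow> bool" where
  "functional d0 T \<longleftrightarrow> single_valued (semantics d0 T)"

end

theory Submission
  imports Defs "HOL-Library.Infinite_Set"
begin

text \<open>Suppose two accepting runs on the same input produce outputs that differ at some
  position, where the first output carries the data value \<open>a\<close>. The data in use at time \<open>n\<close> are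
  \<open>d0\<close>, \<open>a\<close> and the register contents of both runs, at most \<open>2 * k + 2\<close> values. One renames them
  injectively into \<open>X\<close>, extending the renaming by a value of \<open>X\<close> that is not in use whenever a
  new datum is read. Since tests only compare data for equality, both runs survive the renaming.
  Since \<open>a\<close> is in use all the time, its image never changes, and so the outputs still differ at
  the chosen position even if the two runs produce that position at different times.\<close>

section \<open>Infinite concatenations\<close>

lemma concat_prefix:
  assumes "m \<le> n"
  shows "\<exists>v. concat (map u [0..<n]) = concat (map u [0..<m]) @ v"
  using assms
proof (induction n rule: dec_induct)
  case (step n)
  then show ?case by auto
qed simp

lemma concat_length_unbounded:
  assumes "\<exists>\<^sub>\<infinity>n. u n \<noteq> []"
  shows "\<exists>n. j < length (concat (map u [0..<n]))"
proof (induction j)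
  case 0
  obtain n where "u n \<noteq> []"
    using assms by (meson INFM_nat_le)
  then have "0 < length (concat (map u [0..<Suc n]))"
    by simp
  then show ?case by blast
next
  case (Suc j)
  then obtain n where n: "j < length (concat (map u [0..<n]))" by blast
  obtain m where m: "m \<ge> n" "u m \<noteq> []"
    using assms by (meson INFM_nat_le)
  obtain v where "concat (map u [0..<m]) = concat (map u [0..<n]) @ v"
    using concat_prefix[OF m(1)] by blast
  then have "j < length (concat (map u [0..<m]))"
    using n by simp
  moreover have "0 < length (u m)"
    using m(2) by simp
  moreover have "length (concat (map u [0..<Suc m])) = length (concat (map u [0..<m])) + length (u m)"
    by simp
  ultimately have "Suc j < length (concat (map u [0..<Suc m]))"
    by linarith
  then show ?case by blast
qed

text \<open>This turns the prefix condition of \<open>concatenates_to\<close> into one on single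
  positions, the form in which renamed outputs are compared with the original ones.\<close>

lemma shift_eq_iff:
  "(\<exists>w'. w = v @- w') \<longleftrightarrow> (\<forall>j<length v. w !! j = v ! j)"
proof
  assume "\<forall>j<length v. w !! j = v ! j"
  then have "stake (length v) w = v"
    by (intro nth_equalityI) auto
  then have "w = v @- sdrop (length v) w"
    by (metis stake_sdrop)
  then show "\<exists>w'. w = v @- w'" by blast
qed auto

lemma concatenates_to_iff:
  "concatenates_to u w \<longleftrightarrow>
     (\<exists>\<^sub>\<infinity>n. u n \<noteq> []) \<and>
     (\<forall>n. \<forall>j<length (concat (map u [0..<n])). w !! j = concat (map u [0..<n]) ! j)"
  unfolding concatenates_to_def shift_eq_iff ..

text \<open>The finite concatenations are prefixes of each other and grow without bound, so letter
  \<open>j\<close> can be read off any one that is long enough; the choice of \<open>N j\<close>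
  does not affect it.\<close>

lemma concatenates_to_exists:
  assumes "\<exists>\<^sub>\<infinity>n. u n \<noteq> []"
  shows "\<exists>w. concatenates_to u w"
proof -
  obtain N where N: "j < length (concat (map u [0..<N j]))" for j
    using concat_length_unbounded[OF assms] by metis
  define w where "w = smap (\<lambda>j. concat (map u [0..<N j]) ! j) nats"
  have "w !! j = concat (map u [0..<n]) ! j" if "j < length (concat (map u [0..<n]))" for n j
  proof (cases "n \<le> N j")
    case True
    then show ?thesis
      using concat_prefix[OF True, of u] that by (auto simp: w_def nth_append)
  next
    case False
    then have "N j \<le> n" by simp
    then show ?thesis
      using concat_prefix[of "N j" n u] N[of j] by (auto simp: w_def nth_append)
  qed
  then show ?thesis
    using assms unfolding concatenates_to_iff by blast
qed

text \<open>The map \<open>g i\<close> varies with the factor, so it does not commute with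
  \<open>concat\<close> as a single map would. It preserves lengths, however, so position
  \<open>j\<close> lies in the same factor \<open>m\<close> before and after.\<close>

lemma nth_concat_map:
  assumes "j < length (concat (map u [0..<n]))"
  shows "\<exists>m<n. concat (map u [0..<n]) ! j \<in> set (u m) \<and>
    concat (map (\<lambda>i. map (g i) (u i)) [0..<n]) ! j = g m (concat (map u [0..<n]) ! j)"
  using assms
proof (induction n)
  case (Suc n)
  have len: "length (concat (map (\<lambda>i. map (g i) (u i)) [0..<n])) = length (concat (map u [0..<n]))"
    by (simp add: length_concat comp_def)
  show ?case
  proof (cases "j < length (concat (map u [0..<n]))")
    case True
    obtain m where "m < n" "concat (map u [0..<n]) ! j \<in> set (u m)"
      "concat (map (\<lambda>i. map (g i) (u i)) [0..<n]) ! j = g m (concat (map u [0..<n]) ! j)"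
      using Suc.IH[OF True] by blast
    then show ?thesis
      using True len by (intro exI[of _ m]) (simp add: nth_append)
  next
    case False
    then show ?thesis
      using Suc.prems len by (intro exI[of _ n]) (simp add: nth_append)
  qed
qed simp

text \<open>Applied with \<open>g n\<close> the renaming in force at step \<open>n\<close>: each
  letter of the new output comes from the old one by the renaming of the step that produced
  it.\<close>

lemma concatenates_to_map:
  assumes "concatenates_to u w"
  obtains w' where "concatenates_to (\<lambda>n. map (g n) (u n)) w'"
    and "\<And>j. \<exists>n. w !! j \<in> set (u n) \<and> w' !! j = g n (w !! j)"
proof -
  let ?u = "\<lambda>n. map (g n) (u n)"
  have inf: "\<exists>\<^sub>\<infinity>n. u n \<noteq> []"
    using assms by (simp add: concatenates_to_def)
  then obtain w' where w': "concatenates_to ?u w'"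
    using concatenates_to_exists[of ?u] by auto
  have "\<exists>n. w !! j \<in> set (u n) \<and> w' !! j = g n (w !! j)" for j
  proof -
    obtain n where n: "j < length (concat (map u [0..<n]))"
      using concat_length_unbounded[OF inf] by blast
    then have "j < length (concat (map ?u [0..<n]))"
      by (simp add: length_concat comp_def)
    then have "w' !! j = concat (map ?u [0..<n]) ! j" "w !! j = concat (map u [0..<n]) ! j"
      using w' assms n unfolding concatenates_to_iff by blast+
    then show ?thesis
      using nth_concat_map[OF n, of g] by auto
  qed
  with w' show thesis by (rule that)
qed

section \<open>Renaming runs\<close>

lemma test_sat_rename:
  assumes "inj_on f (insert d (range \<tau>))"
  shows "test_sat (f \<circ> \<tau>) (f d) \<phi> \<longleftrightarrow> test_sat \<tau> d \<phi>"
proof -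
  have "f (\<tau> r) = f d \<longleftrightarrow> \<tau> r = d" for r
    by (rule inj_on_eq_iff[OF assms]) auto
  then show ?thesis
    by (induction \<phi>) auto
qed

text \<open>Injectivity on the register contents and the datum read preserves the outcome of the
  test. Updates and outputs only copy values, so they commute with any map.\<close>

lemma step_rename:
  assumes "step T c x out c'" and "inj_on f (insert (snd x) (range (snd c)))"
  shows "step T (fst c, f \<circ> snd c) (apsnd f x) (map (apsnd f) out) (fst c', f \<circ> snd c')"
  using assms(1)
proof cases
  case (1 q \<sigma> \<phi> asgn outr q' \<tau> d \<tau>')
  have "test_sat (f \<circ> \<tau>) (f d) \<phi>"
    using test_sat_rename[of f d \<tau> \<phi>] assms(2) 1 by simp
  moreover have "f \<circ> \<tau>' = update (f \<circ> \<tau>) asgn (f d)"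
    using 1 by (auto simp: update_def)
  ultimately have "step T (q, f \<circ> \<tau>) (\<sigma>, f d)
      (map (\<lambda>(\<gamma>, r). (\<gamma>, (f \<circ> \<tau>') r)) outr) (q', f \<circ> \<tau>')"
    by (rule step.intros[OF 1(5)])
  moreover have "map (\<lambda>(\<gamma>, r). (\<gamma>, (f \<circ> \<tau>') r)) outr = map (apsnd f) out"
    using 1 by auto
  ultimately have "step T (q, f \<circ> \<tau>) (\<sigma>, f d) (map (apsnd f) out) (q', f \<circ> \<tau>')"
    by (simp only:)
  then show ?thesis
    using 1(1,2,4) by simp
qed

text \<open>Configuration \<open>n\<close> is renamed by \<open>f n\<close>, while the datum and the
  output of step \<open>n\<close> are renamed by \<open>f (Suc n)\<close>. The steps fit together
  because both maps agree on the registers of configuration \<open>n\<close>, so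
  \<open>f (Suc n)\<close> alone renames the whole step.\<close>

lemma accepting_run_rename:
  assumes run: "accepting_run d0 T x c out"
    and d0: "f 0 d0 = d0"
    and inj: "\<And>n. inj_on (f (Suc n)) (insert (snd (x !! n)) (range (snd (c n))))"
    and agree: "\<And>n r. f (Suc n) (snd (c n) r) = f n (snd (c n) r)"
  shows "accepting_run d0 T (smap (\<lambda>n. apsnd (f (Suc n)) (x !! n)) nats)
    (\<lambda>n. (fst (c n), f n \<circ> snd (c n))) (\<lambda>n. map (apsnd (f (Suc n))) (out n))"
proof -
  have "f (Suc n) \<circ> snd (c n) = f n \<circ> snd (c n)" for n
    using agree by auto
  then have "step T (fst (c n), f n \<circ> snd (c n)) (apsnd (f (Suc n)) (x !! n))
      (map (apsnd (f (Suc n))) (out n)) (fst (c (Suc n)), f (Suc n) \<circ> snd (c (Suc n)))" for n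
    using step_rename[OF _ inj, of T n "out n" "c (Suc n)"] run
    unfolding accepting_run_def by metis
  then show ?thesis
    using run d0 by (auto simp: accepting_run_def)
qed

section \<open>Data values occurring in a run\<close>

lemma step_range:
  assumes "step T c x out c'"
  shows "range (snd c') \<subseteq> insert (snd x) (range (snd c))"
  using assms by cases (auto simp: update_def)

lemma step_output_range:
  assumes "step T c x out c'" and "p \<in> set out"
  shows "snd p \<in> range (snd c')"
  using assms by cases auto

text \<open>Valuations are defined on the whole register type, which may be infinite. This confines
  their ranges to \<open>d0\<close> and the contents of the \<open>k\<close> actual
  registers.\<close>

lemma accepting_run_outside_registers:
  assumes "nrt T" and "accepting_run d0 T x c out" and "r \<notin> registers T"
  shows "snd (c n) r = d0"
proof (induction n)
  case 0
  then show ?case using assms(2) by (simp add: accepting_run_def)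
next
  case (Suc n)
  have "step T (c n) (x !! n) (out n) (c (Suc n))"
    using assms(2) by (simp add: accepting_run_def)
  then show ?case
  proof cases
    case (1 q \<sigma> \<phi> asgn outr q' \<tau> d \<tau>')
    then have "asgn \<subseteq> registers T"
      using assms(1) by (auto simp: nrt_def)
    then show ?thesis
      using 1 Suc assms(3) by (auto simp: update_def)
  qed
qed

lemma accepting_run_range:
  assumes "nrt T" and "accepting_run d0 T x c out"
  shows "range (snd (c n)) \<subseteq> insert d0 (snd (c n) ` registers T)"
  using accepting_run_outside_registers[OF assms] by blast

text \<open>The renamings are built greedily by dependent choice. At each step the values in use
  leave some element of \<open>X\<close> free for a new datum. The image of a value that has dropped
  out of use may be taken again, so consecutive maps need only agree on \<open>S n\<close>.\<close>

lemma renaming_sequence: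
  fixes S :: "nat \<Rightarrow> 'd set" and d :: "nat \<Rightarrow> 'd"
  assumes fin: "\<And>n. finite (S n)" and card: "\<And>n. infinite X \<or> card (S n) < card X"
    and S: "\<And>n. S (Suc n) \<subseteq> insert (d n) (S n)"
    and g: "inj_on g (S 0)" "g ` S 0 \<subseteq> X"
  obtains f where "\<And>v. v \<in> S 0 \<Longrightarrow> f 0 v = g v"
    and "\<And>n. inj_on (f (Suc n)) (insert (d n) (S n))"
    and "\<And>n. f (Suc n) ` insert (d n) (S n) \<subseteq> X"
    and "\<And>n v. v \<in> S n \<Longrightarrow> f (Suc n) v = f n v"
proof -
  \<comment> \<open>\<open>P\<close> is the invariant of a single renaming, with the start pinned to
    \<open>g\<close>; \<open>Q\<close> relates consecutive renamings.\<close>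
  define P where "P = (\<lambda>n f. inj_on f (S n) \<and> f ` S n \<subseteq> X \<and> (n = 0 \<longrightarrow> f = g))"
  define Q where "Q = (\<lambda>n f f'. inj_on f' (insert (d n) (S n)) \<and>
    f' ` insert (d n) (S n) \<subseteq> X \<and> (\<forall>v\<in>S n. f' v = f v))"
  have extend: "\<exists>f'. P (Suc n) f' \<and> Q n f f'" if "P n f" for n f
  proof -
    have f: "inj_on f (S n)" "f ` S n \<subseteq> X"
      using that by (auto simp: P_def)
    have "\<exists>f'. Q n f f'"
    proof (cases "d n \<in> S n")
      case True
      then have "insert (d n) (S n) = S n" by blast
      then show ?thesis
        using f unfolding Q_def by metis
    next
      case False
      have "\<not> X \<subseteq> f ` S n"
        using card[of n] fin[of n] card_image[OF f(1)]
        by (metis card_mono finite_imageI finite_subset not_less)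
      then obtain v where v: "v \<in> X" "v \<notin> f ` S n" by blast
      have eq: "(f(d n := v)) w = f w" if "w \<in> S n" for w
        using that False by auto
      then have "inj_on (f(d n := v)) (S n)" "(f(d n := v)) ` S n = f ` S n"
        using f(1) by (auto simp: inj_on_def)
      then have "Q n f (f(d n := v))"
        using v f(2) False eq by (auto simp: Q_def)
      then show ?thesis by blast
    qed
    then obtain f' where f': "Q n f f'" by blast
    then have "P (Suc n) f'"
      using S[of n] unfolding P_def Q_def by (auto intro: inj_on_subset)
    with f' show ?thesis by blast
  qed
  have "P 0 g"
    using g by (simp add: P_def)
  then obtain f where f: "P n (f n) \<and> Q n (f n) (f (Suc n))" for n
    using dependent_nat_choice[of P Q] extend by metis
  show thesis
    by (rule that[of f]) (use f in \<open>unfold P_def Q_def, blast+\<close>)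
qed

lemma streams_UNIV_times_iff:
  "w \<in> streams (UNIV \<times> X) \<longleftrightarrow> (\<forall>n. snd (w !! n) \<in> X)"
  unfolding streams_iff_sset sset_range image_subset_iff mem_Times_iff by simp

theorem theorem1:
  fixes T :: "('q, 'r, 's::finite, 'g::finite) transducer"
    and d0 :: "'d::{countable, infinite}"
    and X :: "'d set"
    and k :: nat
  assumes "nrt T"
    and "infinite_outputs d0 T"
    and "card (registers T) = k"
    and "infinite X \<or> card X \<ge> 2 * k + 3"
    and "d0 \<in> X"
  shows "functional d0 T \<longleftrightarrow>
    single_valued (semantics d0 T \<inter> (streams (UNIV \<times> X) \<times> streams (UNIV \<times> X)))"
proof
  assume "functional d0 T"
  then show "single_valued (semantics d0 T \<inter> (streams (UNIV \<times> X) \<times> streams (UNIV \<times> X)))"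
    unfolding functional_def by (rule single_valued_subset[rotated]) simp
next
  assume sv: "single_valued (semantics d0 T \<inter> (streams (UNIV \<times> X) \<times> streams (UNIV \<times> X)))"
  show "functional d0 T"
    unfolding functional_def
  proof (rule single_valuedI, rule ccontr)
    fix x y z
    assume "(x, y) \<in> semantics d0 T" "(x, z) \<in> semantics d0 T" and "y \<noteq> z"
    then obtain c1 o1 c2 o2
      where run1: "accepting_run d0 T x c1 o1" and y: "concatenates_to o1 y"
        and run2: "accepting_run d0 T x c2 o2" and z: "concatenates_to o2 z"
      by (auto simp: semantics_def)
    obtain j where j: "y !! j \<noteq> z !! j"
      using \<open>y \<noteq> z\<close> stream_smap_nats[of y] stream_smap_nats[of z]
      by (metis stream.map_cong0)
    define a where "a = snd (y !! j)"
    define S where "S = (\<lambda>n. {d0, a} \<union> range (snd (c1 n)) \<union> range (snd (c2 n)))"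
    define d where "d = (\<lambda>n. snd (x !! n))"
    have fin_reg: "finite (registers T)"
      using assms(1) by (simp add: nrt_def)
    have S_sub: "S n \<subseteq> {d0, a} \<union> (snd (c1 n) ` registers T \<union> snd (c2 n) ` registers T)" for n
      using accepting_run_range[OF assms(1) run1, of n] accepting_run_range[OF assms(1) run2, of n]
      unfolding S_def by blast
    have fin: "finite (S n)" for n
      by (rule finite_subset[OF S_sub]) (simp add: fin_reg)
    have card: "card (S n) \<le> 2 * k + 2" for n
    proof -
      have "card (S n) \<le> card ({d0, a} \<union> (snd (c1 n) ` registers T \<union> snd (c2 n) ` registers T))"
        by (rule card_mono[OF _ S_sub]) (simp add: fin_reg)
      also have "\<dots> \<le> card {d0, a} + (card (snd (c1 n) ` registers T) + card (snd (c2 n) ` registers T))"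
        by (rule order_trans[OF card_Un_le add_left_mono[OF card_Un_le]])
      also have "\<dots> \<le> 2 + (k + k)"
        using card_image_le[OF fin_reg] assms(3) by (intro add_mono) (auto simp: card_insert_if)
      finally show ?thesis by simp
    qed
    have step1: "step T (c1 n) (x !! n) (o1 n) (c1 (Suc n))"
      and step2: "step T (c2 n) (x !! n) (o2 n) (c2 (Suc n))" for n
      using run1 run2 by (auto simp: accepting_run_def)
    have S_Suc: "S (Suc n) \<subseteq> insert (d n) (S n)" for n
      using step_range[OF step1, of n] step_range[OF step2, of n] by (auto simp: S_def d_def)
    have S_0: "S 0 = {d0, a}"
      using run1 run2 by (auto simp: S_def accepting_run_def)
    \<comment> \<open>At most 2k+2 values are in use against 2k+3 in \<open>X\<close>, so one is
      left for the datum being read.\<close>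
    have card_X: "infinite X \<or> card (S n) < card X" for n
      using assms(4) card[of n] by linarith
    have "\<not> X \<subseteq> {d0}"
      using assms(4) card_mono[of "{d0}" X] finite_subset[of X "{d0}"] by auto
    then obtain b where b: "b \<in> X" "b \<noteq> d0" by blast
    \<comment> \<open>The renamed runs must again start with \<open>d0\<close> in all registers, so
      \<open>d0\<close> is fixed. The map is injective on \<open>{d0, a}\<close> whether or not
      \<open>a\<close> equals \<open>d0\<close>.\<close>
    define g where "g = (\<lambda>v. if v = d0 then d0 else b)"
    have g: "inj_on g (S 0)" "g ` S 0 \<subseteq> X"
      using b assms(5) by (auto simp: g_def S_0)
    obtain f where f0: "\<And>v. v \<in> S 0 \<Longrightarrow> f 0 v = g v"
      and f_inj: "\<And>n. inj_on (f (Suc n)) (insert (d n) (S n))"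
      and f_X: "\<And>n. f (Suc n) ` insert (d n) (S n) \<subseteq> X"
      and f_agree: "\<And>n v. v \<in> S n \<Longrightarrow> f (Suc n) v = f n v"
      using renaming_sequence[OF fin card_X S_Suc g] by metis
    have f_a: "f n a = g a" for n
      by (induction n) (auto simp: f0 f_agree S_0, simp add: S_def f_agree)
    have f_d0: "f 0 d0 = d0"
      using f0[of d0] by (simp add: S_0 g_def)
    \<comment> \<open>The renamings serve both runs at once, since \<open>S n\<close> contains the
      registers of both; hence the renamed runs still share one input.\<close>
    define x' where "x' = smap (\<lambda>n. apsnd (f (Suc n)) (x !! n)) nats"
    have x': "x' \<in> streams (UNIV \<times> X)"
      using f_X by (auto simp: x'_def streams_UNIV_times_iff d_def)
    have run1': "accepting_run d0 T x' (\<lambda>n. (fst (c1 n), f n \<circ> snd (c1 n)))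
        (\<lambda>n. map (apsnd (f (Suc n))) (o1 n))"
      unfolding x'_def
      by (rule accepting_run_rename[OF run1 f_d0 inj_on_subset[OF f_inj] f_agree])
        (auto simp: S_def d_def)
    have run2': "accepting_run d0 T x' (\<lambda>n. (fst (c2 n), f n \<circ> snd (c2 n)))
        (\<lambda>n. map (apsnd (f (Suc n))) (o2 n))"
      unfolding x'_def
      by (rule accepting_run_rename[OF run2 f_d0 inj_on_subset[OF f_inj] f_agree])
        (auto simp: S_def d_def)
    obtain y' where y': "concatenates_to (\<lambda>n. map (apsnd (f (Suc n))) (o1 n)) y'"
      and y'_nth: "\<And>i. \<exists>n. y !! i \<in> set (o1 n) \<and> y' !! i = apsnd (f (Suc n)) (y !! i)"
      using concatenates_to_map[OF y, of "\<lambda>n. apsnd (f (Suc n))"] by blast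
    obtain z' where z': "concatenates_to (\<lambda>n. map (apsnd (f (Suc n))) (o2 n)) z'"
      and z'_nth: "\<And>i. \<exists>n. z !! i \<in> set (o2 n) \<and> z' !! i = apsnd (f (Suc n)) (z !! i)"
      using concatenates_to_map[OF z, of "\<lambda>n. apsnd (f (Suc n))"] by blast
    \<comment> \<open>Outputs are taken from the registers after the update, so their values lie in
      \<open>S (Suc n)\<close>. This is inside \<open>insert (d n) (S n)\<close>, where
      \<open>f (Suc n)\<close> is injective with values in \<open>X\<close>.\<close>
    have out1: "snd p \<in> S (Suc n)" if "p \<in> set (o1 n)" for p n
      using step_output_range[OF step1 that] by (simp add: S_def)
    have out2: "snd p \<in> S (Suc n)" if "p \<in> set (o2 n)" for p n
      using step_output_range[OF step2 that] by (simp add: S_def)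
    have f_X': "f (Suc n) v \<in> X" if "v \<in> S (Suc n)" for n v
      using that S_Suc[of n] f_X[of n] by blast
    have y'_X: "y' \<in> streams (UNIV \<times> X)"
      unfolding streams_UNIV_times_iff using y'_nth out1 f_X' by (metis snd_apsnd)
    have z'_X: "z' \<in> streams (UNIV \<times> X)"
      unfolding streams_UNIV_times_iff using z'_nth out2 f_X' by (metis snd_apsnd)
    have "(x', y') \<in> semantics d0 T" "(x', z') \<in> semantics d0 T"
      using run1' y' run2' z' unfolding semantics_def by blast+
    then have eq: "y' = z'"
      using sv x' y'_X z'_X unfolding single_valued_def by blast
    \<comment> \<open>Position \<open>j\<close> may be produced at different steps \<open>n\<close>
      and \<open>m\<close> of the two runs.\<close>
    obtain n where n: "y' !! j = apsnd (f (Suc n)) (y !! j)"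
      using y'_nth by blast
    obtain m where m: "z !! j \<in> set (o2 m)" "z' !! j = apsnd (f (Suc m)) (z !! j)"
      using z'_nth by blast
    have fst: "fst (y !! j) = fst (z !! j)"
      using n m eq by (metis fst_apsnd)
    \<comment> \<open>Both \<open>f (Suc n)\<close> and \<open>f (Suc m)\<close> send
      \<open>a\<close> to \<open>g a\<close>, which moves the comparison to the single step
      \<open>m\<close>, where injectivity applies.\<close>
    have "f (Suc m) (snd (z !! j)) = f (Suc m) a"
      using n m eq f_a by (metis a_def snd_apsnd)
    moreover have "snd (z !! j) \<in> insert (d m) (S m)" "a \<in> insert (d m) (S m)"
      using out2[OF m(1)] S_Suc[of m] by (auto simp: S_def)
    ultimately have "snd (z !! j) = a"
      using inj_onD[OF f_inj[of m]] by blast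
    with fst j show False
      by (simp add: a_def prod_eq_iff)
  qed
qed

end
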